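(* Suppose that $S$ is a monoid and that $S=\langle G\cup\{z\}\rangle$, where $G=G(S)$ is the group of units of $S$ and $z\in S$ satisfies $z^3=z$. Then $S$ is inverse with $$E(S)=\langle g^{-1}z^2g\mid g\in G\rangle\quad\text{and}\quad F(S)=\langle G\cup\{z^2\}\rangle$$ if and only if, for all $g\in G$, (C1) $g^{-1}z^2gz^2=z^2g^{-1}z^2g$, and (C2) $zg^{-1}z^2gz\in\langle G\cup\{z^2\}\rangle$.
   Context: For a monoid $S$, $E(S)$ is its set of idempotents, $G(S)$ its group of units, and for $Y\subseteq S$, $\langle Y\rangle$ is the submonoid of $S$ generated by $Y$. If $S$ is an inverse monoid, its factorizable part is $F(S)=E(S)G(S)=G(S)E(S)$. A monoid is inverse if every element $a$ has a unique $b$ with $aba=a$ and $bab=b$. *)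

theory Defs
  imports "HOL-Algebra.Coset" "HOL.Hull"
begin

(* The submonoid generated by Y. Unlike the library constant generate, it is not closed
   under inverses of generators; gen_submonoid_eq_hull identifies it with the least
   submonoid containing Y. *)
inductive_set gen_submonoid :: "('a, 'b) monoid_scheme \<Rightarrow> 'a set \<Rightarrow> 'a set"
  for S and Y where
    one: "\<one>\<^bsub>S\<^esub> \<in> gen_submonoid S Y"
  | incl: "y \<in> Y \<Longrightarrow> y \<in> gen_submonoid S Y"
  | mult: "a \<in> gen_submonoid S Y \<Longrightarrow> b \<in> gen_submonoid S Y
      \<Longrightarrow> a \<otimes>\<^bsub>S\<^esub> b \<in> gen_submonoid S Y"

definition idempotents :: "('a, 'b) monoid_scheme \<Rightarrow> 'a set" where
  "idempotents S = {e \<in> carrier S. e \<otimes>\<^bsub>S\<^esub> e = e}"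

locale inverse_monoid = monoid S for S (structure) +
  assumes unique_inverse:
    "a \<in> carrier S \<Longrightarrow> \<exists>!b. b \<in> carrier S \<and> a \<otimes> b \<otimes> a = a \<and> b \<otimes> a \<otimes> b = b"

(* E(S)G(S); it equals G(S)E(S) by factorizable_part_eq. *)
definition factorizable_part :: "('a, 'b) monoid_scheme \<Rightarrow> 'a set" where
  "factorizable_part S = idempotents S <#>\<^bsub>S\<^esub> Units S"

lemma (in monoid) gen_submonoid_submonoid:
  assumes "Y \<subseteq> carrier G"
  shows "submonoid (gen_submonoid G Y) G"
proof
  show "gen_submonoid G Y \<subseteq> carrier G"
  proof
    fix x assume "x \<in> gen_submonoid G Y"
    then show "x \<in> carrier G"
      by induction (use assms in auto)
  qed
qed (auto intro: gen_submonoid.intros)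

lemma (in monoid) gen_submonoid_eq_hull:
  assumes "Y \<subseteq> carrier G"
  shows "gen_submonoid G Y = (\<lambda>H. submonoid H G) hull Y"
proof (rule sym, rule hull_unique)
  show "Y \<subseteq> gen_submonoid G Y"
    by (auto intro: gen_submonoid.incl)
  show "submonoid (gen_submonoid G Y) G"
    by (rule gen_submonoid_submonoid[OF assms])
  fix H assume "Y \<subseteq> H" and H: "submonoid H G"
  show "gen_submonoid G Y \<subseteq> H"
  proof
    fix x assume "x \<in> gen_submonoid G Y"
    then show "x \<in> H"
      by induction
        (use \<open>Y \<subseteq> H\<close> submonoid.one_closed[OF H] submonoid.m_closed[OF H] in auto)
  qed
qed

lemma (in monoid) idempotents_conj:
  assumes "e \<in> idempotents G" "g \<in> Units G"
  shows "inv g \<otimes> e \<otimes> g \<in> idempotents G"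
proof -
  have c: "e \<in> carrier G" "g \<in> carrier G" "inv g \<in> carrier G" and ee: "e \<otimes> e = e"
    using assms by (auto simp: idempotents_def)
  have "(inv g \<otimes> e \<otimes> g) \<otimes> (inv g \<otimes> e \<otimes> g) = inv g \<otimes> (e \<otimes> (g \<otimes> inv g) \<otimes> e) \<otimes> g"
    using c by (simp add: m_assoc del: Units_r_inv)
  also have "\<dots> = inv g \<otimes> e \<otimes> g"
    using c ee assms(2) by simp
  finally show ?thesis
    using c by (simp add: idempotents_def)
qed

lemma (in monoid) factorizable_part_eq:
  "factorizable_part G = Units G <#> idempotents G"
proof (intro equalityI subsetI)
  fix x assume "x \<in> factorizable_part G"
  then obtain e g where *: "e \<in> idempotents G" "g \<in> Units G" "x = e \<otimes> g"
    by (auto simp: factorizable_part_def set_mult_def)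
  then have c: "e \<in> carrier G" "g \<in> carrier G" "inv g \<in> carrier G"
    by (auto simp: idempotents_def)
  have "g \<otimes> (inv g \<otimes> e \<otimes> g) = (g \<otimes> inv g) \<otimes> e \<otimes> g"
    using c by (simp add: m_assoc del: Units_r_inv)
  then have "x = g \<otimes> (inv g \<otimes> e \<otimes> g)"
    using * c by simp
  then show "x \<in> Units G <#> idempotents G"
    using idempotents_conj[OF *(1,2)] *(2) by (auto simp: set_mult_def)
next
  fix x assume "x \<in> Units G <#> idempotents G"
  then obtain e g where *: "e \<in> idempotents G" "g \<in> Units G" "x = g \<otimes> e"
    by (auto simp: set_mult_def)
  then have c: "e \<in> carrier G" "g \<in> carrier G" "inv g \<in> carrier G"
    by (auto simp: idempotents_def)
  have "g \<otimes> e \<otimes> inv g \<otimes> g = g \<otimes> e \<otimes> (inv g \<otimes> g)"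
    using c by (simp add: m_assoc del: Units_l_inv)
  then have "x = (g \<otimes> e \<otimes> inv g) \<otimes> g"
    using * c by simp
  moreover have "g \<otimes> e \<otimes> inv g \<in> idempotents G"
    using idempotents_conj[OF *(1) Units_inv_Units[OF *(2)]] *(2) by simp
  ultimately show "x \<in> factorizable_part G"
    using *(2) by (auto simp: factorizable_part_def set_mult_def)
qed

end

(* If e = z^2 then E, generated by the conjugates of e, is a commutative monoid of idempotents by
   (C1), it is normalised by the units, and <G, e> = E G. An idempotent f h of E G equals f, so (C2)
   gives z E z <= E. Hence every x in <G, z> has an inverse x' with x E x' and x' E x contained in E,
   and if x is idempotent, then x' = (x' x)(x x') and x = (x x')(x' x) lie in E. So E = E(S), and S
   is regular with commuting idempotents, i.e. inverse. Conversely, idempotents of an inverse monoid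
   commute, which makes z p z idempotent for every idempotent p. *)
theory Submission
  imports Defs
begin

section \<open>Inverse monoids and commuting idempotents\<close>

lemma (in inverse_monoid) inverse_eqI:
  assumes "a \<in> carrier S" "b \<in> carrier S" "c \<in> carrier S"
    and "a \<otimes> b \<otimes> a = a" "b \<otimes> a \<otimes> b = b" "a \<otimes> c \<otimes> a = a" "c \<otimes> a \<otimes> c = c"
  shows "b = c"
  using unique_inverse[OF assms(1)] assms by blast

text \<open>If \<open>x\<close> is the inverse of \<open>e f\<close>, then \<open>f x e\<close> is
  an inverse of \<open>e f\<close> as well, so \<open>x = f x e\<close>, which makes
  \<open>x\<close> idempotent. Now \<open>x\<close> and \<open>e f\<close> are both inverses of
  \<open>x\<close>, hence equal.\<close>

lemma (in inverse_monoid) idempotents_mult_closed: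
  assumes "e \<in> idempotents S" "f \<in> idempotents S"
  shows "e \<otimes> f \<in> idempotents S"
proof -
  have c: "e \<in> carrier S" "f \<in> carrier S" and ee: "e \<otimes> e = e" and ff: "f \<otimes> f = f"
    using assms by (auto simp: idempotents_def)
  have eel: "e \<otimes> (e \<otimes> y) = e \<otimes> y" if "y \<in> carrier S" for y
    using that c ee m_assoc by metis
  have ffl: "f \<otimes> (f \<otimes> y) = f \<otimes> y" if "y \<in> carrier S" for y
    using that c ff m_assoc by metis
  obtain x where x: "x \<in> carrier S" "(e \<otimes> f) \<otimes> x \<otimes> (e \<otimes> f) = e \<otimes> f" "x \<otimes> (e \<otimes> f) \<otimes> x = x"
    using unique_inverse[of "e \<otimes> f"] c by blast
  have "x = f \<otimes> x \<otimes> e"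
  proof (rule inverse_eqI[of "e \<otimes> f"])
    show "(e \<otimes> f) \<otimes> (f \<otimes> x \<otimes> e) \<otimes> (e \<otimes> f) = e \<otimes> f"
      using x c by (simp add: m_assoc eel ffl)
    have "(f \<otimes> x \<otimes> e) \<otimes> (e \<otimes> f) \<otimes> (f \<otimes> x \<otimes> e) = f \<otimes> (x \<otimes> (e \<otimes> f) \<otimes> x) \<otimes> e"
      using x(1) c by (simp add: m_assoc eel ffl)
    then show "(f \<otimes> x \<otimes> e) \<otimes> (e \<otimes> f) \<otimes> (f \<otimes> x \<otimes> e) = f \<otimes> x \<otimes> e"
      using x by simp
  qed (use x c in auto)
  moreover have "(f \<otimes> x \<otimes> e) \<otimes> (f \<otimes> x \<otimes> e) = f \<otimes> (x \<otimes> (e \<otimes> f) \<otimes> x) \<otimes> e"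
    using x(1) c by (simp add: m_assoc)
  ultimately have xx: "x \<otimes> x = x"
    using x by simp
  have "x = e \<otimes> f"
    by (rule inverse_eqI[of x]) (use x c xx in auto)
  with xx c show ?thesis
    by (simp add: idempotents_def)
qed

text \<open>Both \<open>e f\<close> and \<open>f e\<close> are inverses of \<open>e f\<close>: the
  first because it is idempotent, the second because the idempotence of \<open>e f\<close> and
  \<open>f e\<close> collapses the products.\<close>

lemma (in inverse_monoid) idempotents_commute:
  assumes "e \<in> idempotents S" "f \<in> idempotents S"
  shows "e \<otimes> f = f \<otimes> e"
proof -
  have c: "e \<in> carrier S" "f \<in> carrier S" and ee: "e \<otimes> e = e" and ff: "f \<otimes> f = f"
    using assms by (auto simp: idempotents_def)
  have eel: "e \<otimes> (e \<otimes> y) = e \<otimes> y" if "y \<in> carrier S" for y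
    using that c ee m_assoc by metis
  have ffl: "f \<otimes> (f \<otimes> y) = f \<otimes> y" if "y \<in> carrier S" for y
    using that c ff m_assoc by metis
  have ef: "(e \<otimes> f) \<otimes> (e \<otimes> f) = e \<otimes> f" and fe: "(f \<otimes> e) \<otimes> (f \<otimes> e) = f \<otimes> e"
    using idempotents_mult_closed assms by (auto simp: idempotents_def)
  show ?thesis
  proof (rule inverse_eqI[of "e \<otimes> f"])
    show "(e \<otimes> f) \<otimes> (f \<otimes> e) \<otimes> (e \<otimes> f) = e \<otimes> f"
      using c ef by (simp add: m_assoc eel ffl)
    show "(f \<otimes> e) \<otimes> (e \<otimes> f) \<otimes> (f \<otimes> e) = f \<otimes> e"
      using c fe by (simp add: m_assoc eel ffl)
  qed (use c ef in simp_all)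
qed

text \<open>Only uniqueness needs an argument. For inverses \<open>b\<close> and \<open>c\<close> of
  \<open>a\<close>, swapping the idempotents \<open>a c\<close> and \<open>a b\<close> turns
  \<open>b\<close> into \<open>b a c\<close>, and swapping \<open>b a\<close> and \<open>c a\<close>
  turns \<open>b a c\<close> into \<open>c\<close>.\<close>

lemma (in monoid) inverse_monoidI:
  assumes reg: "\<And>a. a \<in> carrier G \<Longrightarrow> \<exists>b\<in>carrier G. a \<otimes> b \<otimes> a = a \<and> b \<otimes> a \<otimes> b = b"
    and comm: "\<And>e f. e \<in> idempotents G \<Longrightarrow> f \<in> idempotents G \<Longrightarrow> e \<otimes> f = f \<otimes> e"
  shows "inverse_monoid G"
proof
  fix a assume a: "a \<in> carrier G"
  have "b = c" if b: "b \<in> carrier G" "a \<otimes> b \<otimes> a = a" "b \<otimes> a \<otimes> b = b"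
    and c: "c \<in> carrier G" "a \<otimes> c \<otimes> a = a" "c \<otimes> a \<otimes> c = c" for b c
  proof -
    have idem: "a \<otimes> b \<in> idempotents G" "b \<otimes> a \<in> idempotents G"
      "a \<otimes> c \<in> idempotents G" "c \<otimes> a \<in> idempotents G"
      using a b c by (simp_all add: idempotents_def m_assoc[symmetric])
    have "b = b \<otimes> (a \<otimes> c \<otimes> a) \<otimes> b"
      using b c by simp
    also have "\<dots> = b \<otimes> ((a \<otimes> c) \<otimes> (a \<otimes> b))"
      using a b(1) c(1) by (simp add: m_assoc)
    also have "\<dots> = b \<otimes> ((a \<otimes> b) \<otimes> (a \<otimes> c))"
      using comm idem by simp
    also have "\<dots> = (b \<otimes> a \<otimes> b) \<otimes> a \<otimes> c"
      using a b(1) c(1) by (simp add: m_assoc)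
    also have "\<dots> = b \<otimes> a \<otimes> (c \<otimes> a \<otimes> c)"
      using a b c by simp
    also have "\<dots> = ((b \<otimes> a) \<otimes> (c \<otimes> a)) \<otimes> c"
      using a b(1) c(1) by (simp add: m_assoc)
    also have "\<dots> = ((c \<otimes> a) \<otimes> (b \<otimes> a)) \<otimes> c"
      using comm idem by simp
    also have "\<dots> = c \<otimes> (a \<otimes> b \<otimes> a) \<otimes> c"
      using a b(1) c(1) by (simp add: m_assoc)
    also have "\<dots> = c"
      using b c by simp
    finally show ?thesis .
  qed
  with reg[OF a] show "\<exists>!b. b \<in> carrier G \<and> a \<otimes> b \<otimes> a = a \<and> b \<otimes> a \<otimes> b = b"
    by blast
qed

section \<open>Generated submonoids and conjugation by units\<close>

lemma (in monoid) gen_submonoid_subset: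
  assumes "Y \<subseteq> carrier G" "Y \<subseteq> gen_submonoid G Z"
  shows "gen_submonoid G Y \<subseteq> gen_submonoid G Z"
proof
  fix x assume "x \<in> gen_submonoid G Y"
  then show "x \<in> gen_submonoid G Z"
    by induction (use assms in \<open>auto intro: gen_submonoid.intros\<close>)
qed

text \<open>One induction, used twice: whatever commutes with the generators commutes with all they
  generate. It is applied first to a generator, then to an arbitrary generated element.\<close>

lemma (in monoid) gen_submonoid_commute:
  assumes Y: "Y \<subseteq> carrier G"
    and comm: "\<And>x y. x \<in> Y \<Longrightarrow> y \<in> Y \<Longrightarrow> x \<otimes> y = y \<otimes> x"
    and "x \<in> gen_submonoid G Y" "y \<in> gen_submonoid G Y"
  shows "x \<otimes> y = y \<otimes> x"
proof -
  have closed: "gen_submonoid G Y \<subseteq> carrier G"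
    using gen_submonoid_submonoid[OF Y] submonoid.subset by blast
  have commute_with: "a \<otimes> b = b \<otimes> a"
    if "b \<in> gen_submonoid G Y" and a: "a \<in> carrier G" and "\<And>y. y \<in> Y \<Longrightarrow> a \<otimes> y = y \<otimes> a" for a b
    using that(1)
  proof induction
    case (mult b c)
    then have "b \<in> carrier G" "c \<in> carrier G"
      using closed by auto
    then show ?case
      using mult.IH a m_assoc by metis
  qed (use that in auto)
  show ?thesis
    using commute_with[OF assms(4)] commute_with[OF assms(3)] comm closed Y assms(3) by (metis subsetD)
qed

text \<open>After rewriting with \<open>m_assoc\<close> products nest to the right, so a unit and
  its inverse meet only in front of a remaining factor. These rules cancel them there.\<close>

lemma (in monoid) Units_cancel [simp]:
  assumes "g \<in> Units G" "x \<in> carrier G"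
  shows "inv g \<otimes> (g \<otimes> x) = x" "g \<otimes> (inv g \<otimes> x) = x"
  using assms m_assoc[of "inv g" g x] m_assoc[of g "inv g" x] by (auto simp: Units_closed)

lemma (in monoid) conj_distrib:
  assumes "g \<in> Units G" "x \<in> carrier G" "y \<in> carrier G"
  shows "inv g \<otimes> (x \<otimes> y) \<otimes> g = (inv g \<otimes> x \<otimes> g) \<otimes> (inv g \<otimes> y \<otimes> g)"
  using assms by (simp add: m_assoc Units_closed)

lemma (in monoid) inv_mult_Units:
  assumes "g \<in> Units G" "h \<in> Units G"
  shows "inv (g \<otimes> h) = inv h \<otimes> inv g"
  by (rule inv_unique'[symmetric]) (use assms in \<open>simp_all add: m_assoc Units_closed Units_m_closed\<close>)

lemma (in monoid) conj_conj:
  assumes "g \<in> Units G" "h \<in> Units G" "x \<in> carrier G"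
  shows "inv h \<otimes> (inv g \<otimes> x \<otimes> g) \<otimes> h = inv (g \<otimes> h) \<otimes> x \<otimes> (g \<otimes> h)"
  using assms by (simp add: inv_mult_Units m_assoc Units_closed)

section \<open>The monoid generated by the conjugates of an idempotent\<close>

text \<open>Isolates what follows from (C1) alone: \<open>e\<close> stands for \<open>z^2\<close>,
  and \<open>z\<close> itself does not occur.\<close>

locale conj_commuting_idempotent = monoid S for S (structure) +
  fixes e
  assumes e_closed [simp]: "e \<in> carrier S"
    and e_idem: "e \<otimes> e = e"
    and conj_commute: "g \<in> Units S \<Longrightarrow> (inv g \<otimes> e \<otimes> g) \<otimes> e = e \<otimes> (inv g \<otimes> e \<otimes> g)"
begin

abbreviation "conjugates \<equiv> {inv g \<otimes> e \<otimes> g | g. g \<in> Units S}"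
abbreviation "E \<equiv> gen_submonoid S conjugates"

lemma conjugates_closed: "conjugates \<subseteq> carrier S"
  by (auto simp: Units_closed)

lemma E_closed: "x \<in> E \<Longrightarrow> x \<in> carrier S"
  using gen_submonoid_submonoid[OF conjugates_closed] submonoid.subset by blast

text \<open>Conjugation by a unit respects products and sends a conjugate of \<open>e\<close> to
  another one, so it preserves the submonoid they generate.\<close>

lemma conj_in_E:
  assumes "x \<in> E" "h \<in> Units S"
  shows "inv h \<otimes> x \<otimes> h \<in> E"
  using assms(1)
proof induction
  case one
  then show ?case using assms by (auto intro: gen_submonoid.one)
next
  case (incl y)
  then obtain g where "g \<in> Units S" "y = inv g \<otimes> e \<otimes> g"
    by blast
  with assms(2) have "inv h \<otimes> y \<otimes> h = inv (g \<otimes> h) \<otimes> e \<otimes> (g \<otimes> h)" "g \<otimes> h \<in> Units S"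
    by (auto simp: conj_conj)
  then show ?case
    by (blast intro: gen_submonoid.incl)
next
  case (mult x y)
  then show ?case
    using conj_distrib[OF assms(2)] E_closed by (auto intro: gen_submonoid.mult)
qed

lemma conj_inv_in_E:
  assumes "x \<in> E" "h \<in> Units S"
  shows "h \<otimes> x \<otimes> inv h \<in> E"
  using conj_in_E[OF assms(1), of "inv h"] assms(2) by simp

text \<open>The assumption covers only pairs in which one member is \<open>e\<close> itself. With
  \<open>k = g h^-1\<close> the two conjugates are the conjugates by \<open>h\<close> of
  \<open>k^-1 e k\<close> and of \<open>e\<close>, and these commute.\<close>

lemma conjugates_commute:
  assumes "x \<in> conjugates" "y \<in> conjugates"
  shows "x \<otimes> y = y \<otimes> x"
proof -
  obtain g h where g: "g \<in> Units S" "x = inv g \<otimes> e \<otimes> g" and h: "h \<in> Units S" "y = inv h \<otimes> e \<otimes> h"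
    using assms by blast
  define k where "k = g \<otimes> inv h"
  have k: "k \<in> Units S"
    using g h by (simp add: k_def)
  have "inv h \<otimes> (inv k \<otimes> e \<otimes> k) \<otimes> h = inv (k \<otimes> h) \<otimes> e \<otimes> (k \<otimes> h)"
    using conj_conj k h by simp
  also have "k \<otimes> h = g"
    using g h by (simp add: k_def m_assoc Units_closed)
  finally have x: "x = inv h \<otimes> (inv k \<otimes> e \<otimes> k) \<otimes> h"
    using g by simp
  have kc: "inv k \<otimes> e \<otimes> k \<in> carrier S"
    using k by (simp add: Units_closed)
  show ?thesis
    unfolding x h(2) conj_distrib[OF h(1) kc e_closed, symmetric]
      conj_distrib[OF h(1) e_closed kc, symmetric] conj_commute[OF k] ..
qed

lemma E_commute: "x \<in> E \<Longrightarrow> y \<in> E \<Longrightarrow> x \<otimes> y = y \<otimes> x"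
  using gen_submonoid_commute[OF conjugates_closed] conjugates_commute by blast

lemma E_idem:
  assumes "x \<in> E"
  shows "x \<otimes> x = x"
  using assms
proof induction
  case (incl y)
  then obtain g where "g \<in> Units S" "y = inv g \<otimes> e \<otimes> g"
    by blast
  then show ?case
    using conj_distrib[of g e e] e_idem by simp
next
  case (mult x y)
  have c: "x \<in> carrier S" "y \<in> carrier S"
    using mult.hyps E_closed by auto
  have "(x \<otimes> y) \<otimes> (x \<otimes> y) = x \<otimes> (y \<otimes> x) \<otimes> y"
    using c by (simp add: m_assoc)
  also have "\<dots> = (x \<otimes> x) \<otimes> (y \<otimes> y)"
    unfolding E_commute[OF mult.hyps(2,1)] using c by (simp add: m_assoc)
  finally show ?case
    using mult.IH by simp
qed simp

lemma e_in_E: "e \<in> E"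
proof (rule gen_submonoid.incl)
  have "e = inv \<one> \<otimes> e \<otimes> \<one>"
    by simp
  then show "e \<in> conjugates"
    using Units_one_closed by blast
qed

lemma E_Units_memI: "x \<in> E \<Longrightarrow> g \<in> Units S \<Longrightarrow> x \<otimes> g \<in> E <#> Units S"
  unfolding set_mult_def by blast

lemma gen_submonoid_Units_eq: "gen_submonoid S (Units S \<union> {e}) = E <#> Units S"
proof (intro equalityI subsetI)
  fix x assume "x \<in> gen_submonoid S (Units S \<union> {e})"
  then show "x \<in> E <#> Units S"
  proof induction
    case one
    show ?case
      using E_Units_memI[of \<one> \<one>] gen_submonoid.one[of S conjugates] by simp
  next
    case (incl y)
    then consider "y \<in> Units S" | "y = e"
      by blast
    then show ?case
    proof cases
      case 1
      then show ?thesis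
        using E_Units_memI[of \<one> y] gen_submonoid.one[of S conjugates] by (simp add: Units_closed)
    next
      case 2
      then show ?thesis
        using E_Units_memI[of e \<one>] e_in_E by simp
    qed
  next
    case (mult a b)
    then obtain p g q h where *: "p \<in> E" "g \<in> Units S" "a = p \<otimes> g" "q \<in> E" "h \<in> Units S" "b = q \<otimes> h"
      by (auto simp: set_mult_def)
    \<comment> \<open>Moving \<open>g\<close> to the right past \<open>q\<close> replaces
      \<open>q\<close> by a conjugate, which stays in \<open>E\<close>; hence the product set is
      closed under multiplication.\<close>
    then have "a \<otimes> b = (p \<otimes> (g \<otimes> q \<otimes> inv g)) \<otimes> (g \<otimes> h)"
      by (simp add: m_assoc Units_closed E_closed)
    moreover have "p \<otimes> (g \<otimes> q \<otimes> inv g) \<in> E"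
      using * conj_inv_in_E by (blast intro: gen_submonoid.mult)
    ultimately show ?case
      using E_Units_memI * by simp
  qed
next
  have gen: "Units S \<subseteq> gen_submonoid S (Units S \<union> {e})" "e \<in> gen_submonoid S (Units S \<union> {e})"
    by (auto intro: gen_submonoid.incl)
  then have "conjugates \<subseteq> gen_submonoid S (Units S \<union> {e})"
    by (auto intro!: gen_submonoid.mult)
  then have "E \<subseteq> gen_submonoid S (Units S \<union> {e})"
    by (rule gen_submonoid_subset[OF conjugates_closed])
  moreover fix x assume "x \<in> E <#> Units S"
  ultimately show "x \<in> gen_submonoid S (Units S \<union> {e})"
    using gen(1) by (auto simp: set_mult_def intro: gen_submonoid.mult)
qed

text \<open>Write \<open>x = f h\<close> with \<open>f\<close> in \<open>E\<close> and
  \<open>h\<close> a unit. Idempotence of \<open>x\<close> forces \<open>k = f h^-1\<close> into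
  \<open>E\<close>. Since \<open>k h = f\<close>, one gets \<open>f = k k h = k f = f k = k\<close>,
  so \<open>x = f h = k h = f\<close>.\<close>

lemma idempotent_in_E:
  assumes "x \<in> gen_submonoid S (Units S \<union> {e})" and xx: "x \<otimes> x = x"
  shows "x \<in> E"
proof -
  obtain f h where f: "f \<in> E" and h: "h \<in> Units S" and x: "x = f \<otimes> h"
    using assms(1) unfolding gen_submonoid_Units_eq set_mult_def by blast
  define f' where "f' = h \<otimes> f \<otimes> inv h"
  have f': "f' \<in> E"
    using conj_inv_in_E f h by (simp add: f'_def)
  note c = E_closed[OF f] E_closed[OF f'] Units_closed[OF h]
  \<comment> \<open>Here \<open>x x = f f' h h\<close>; cancelling \<open>h h\<close> in
    \<open>x x = x\<close> exhibits \<open>f h^-1\<close> as the product \<open>f f'\<close> of two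
    members of \<open>E\<close>.\<close>
  have "f \<otimes> f' = (x \<otimes> x) \<otimes> (inv h \<otimes> inv h)"
    using c h by (simp add: x f'_def m_assoc)
  also have "\<dots> = f \<otimes> inv h"
    using c h by (simp add: xx) (simp add: x m_assoc)
  finally have *: "f \<otimes> f' = f \<otimes> inv h" .
  define k where "k = f \<otimes> inv h"
  have k: "k \<in> E"
    unfolding k_def *[symmetric] using f f' by (rule gen_submonoid.mult)
  have kh: "k \<otimes> h = f"
    using c h by (simp add: k_def m_assoc)
  have "f = (k \<otimes> k) \<otimes> h"
    by (simp add: E_idem[OF k] kh)
  also have "\<dots> = k \<otimes> f"
    using E_closed[OF k] c kh by (simp add: m_assoc)
  also have "\<dots> = f \<otimes> k"
    by (rule E_commute[OF k f])
  also have "\<dots> = k"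
    unfolding k_def using c h E_idem[OF f] by (simp add: m_assoc[symmetric])
  finally show ?thesis
    using kh f by (simp add: x)
qed

end

section \<open>Adjoining \<open>z\<close>: inverses and idempotents of the whole monoid\<close>

text \<open>The assumption \<open>ez\<close> is \<open>z^3 = z\<close>, and \<open>sandwich\<close>
  is (C2), both with \<open>e\<close> written for \<open>z^2\<close>.\<close>

locale sandwich_condition = conj_commuting_idempotent +
  fixes z
  assumes z_closed [simp]: "z \<in> carrier S"
    and zz: "z \<otimes> z = e"
    and ez: "e \<otimes> z = z"
    and gen: "carrier S = gen_submonoid S (Units S \<union> {z})"
    and sandwich: "g \<in> Units S \<Longrightarrow>
      z \<otimes> (inv g \<otimes> e \<otimes> g) \<otimes> z \<in> gen_submonoid S (Units S \<union> {e})"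
begin

text \<open>The inner \<open>z z = e\<close> commutes with \<open>p\<close> and is then absorbed by
  \<open>z e = z\<close>. Thus \<open>x\<close> to \<open>z x z\<close> respects products on
  \<open>E\<close>.\<close>

lemma sandwich_mult:
  assumes "p \<in> E" "q \<in> carrier S"
  shows "(z \<otimes> p \<otimes> z) \<otimes> (z \<otimes> q \<otimes> z) = z \<otimes> (p \<otimes> q) \<otimes> z"
proof -
  have ze: "z \<otimes> e = z"
    using ez zz m_assoc[of z z z] by simp
  have p: "p \<in> carrier S"
    using E_closed assms(1) by blast
  have "(z \<otimes> p \<otimes> z) \<otimes> (z \<otimes> q \<otimes> z) = z \<otimes> (p \<otimes> (z \<otimes> z)) \<otimes> q \<otimes> z"
    using p assms(2) by (simp add: m_assoc)
  also have "\<dots> = (z \<otimes> e) \<otimes> p \<otimes> q \<otimes> z"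
    unfolding zz E_commute[OF assms(1) e_in_E] using p assms(2) by (simp add: m_assoc)
  finally show ?thesis
    unfolding ze using p assms(2) by (simp add: m_assoc)
qed

text \<open>By \<open>sandwich_mult\<close> it suffices to treat generators, apart from
  \<open>z z = e\<close> for the identity. For a conjugate \<open>y\<close> of \<open>e\<close>,
  (C2) puts \<open>z y z\<close> into the submonoid generated by the units and \<open>e\<close>, and
  \<open>sandwich_mult\<close> makes it idempotent, so \<open>idempotent_in_E\<close>
  applies.\<close>

lemma sandwich_in_E:
  assumes "x \<in> E"
  shows "z \<otimes> x \<otimes> z \<in> E"
  using assms
proof induction
  case one
  then show ?case
    by (simp add: zz e_in_E)
next
  case (incl y)
  then have y: "y \<in> E"
    by (rule gen_submonoid.incl)
  show ?case
  proof (rule idempotent_in_E)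
    show "z \<otimes> y \<otimes> z \<in> gen_submonoid S (Units S \<union> {e})"
      using incl sandwich by blast
    show "(z \<otimes> y \<otimes> z) \<otimes> (z \<otimes> y \<otimes> z) = z \<otimes> y \<otimes> z"
      using sandwich_mult[OF y E_closed[OF y]] E_idem[OF y] by simp
  qed
next
  case (mult a b)
  then have "z \<otimes> (a \<otimes> b) \<otimes> z = (z \<otimes> a \<otimes> z) \<otimes> (z \<otimes> b \<otimes> z)"
    using sandwich_mult E_closed by simp
  with mult.IH show ?case
    by (simp only: gen_submonoid.mult)
qed

text \<open>The clause about \<open>E\<close> makes the notion stable under products, which an
  induction over the generators requires.\<close>

definition inverse_normalizing :: "'a \<Rightarrow> 'a \<Rightarrow> bool" where
  "inverse_normalizing x y \<longleftrightarrow> y \<in> carrier S \<and> x \<otimes> y \<otimes> x = x \<and> y \<otimes> x \<otimes> y = y \<and>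
     (\<forall>p\<in>E. x \<otimes> p \<otimes> y \<in> E \<and> y \<otimes> p \<otimes> x \<in> E)"

text \<open>The clause about \<open>E\<close> at \<open>p = \<one>\<close> places
  \<open>a' a\<close> and \<open>b b'\<close> in \<open>E\<close>, where they commute. This is what
  makes \<open>b' a'\<close> an inverse of \<open>a b\<close>. The clause itself passes to products
  by nesting the two maps.\<close>

lemma inverse_normalizing_mult:
  assumes c: "a \<in> carrier S" "b \<in> carrier S"
    and a: "inverse_normalizing a a'" and b: "inverse_normalizing b b'"
  shows "inverse_normalizing (a \<otimes> b) (b' \<otimes> a')"
proof -
  have c': "a' \<in> carrier S" "b' \<in> carrier S"
    using a b by (auto simp: inverse_normalizing_def)
  have "a' \<otimes> \<one> \<otimes> a \<in> E" "b \<otimes> \<one> \<otimes> b' \<in> E"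
    using a b gen_submonoid.one[of S conjugates] by (auto simp: inverse_normalizing_def)
  then have comm: "(a' \<otimes> a) \<otimes> (b \<otimes> b') = (b \<otimes> b') \<otimes> (a' \<otimes> a)"
    using E_commute[of "a' \<otimes> \<one> \<otimes> a" "b \<otimes> \<one> \<otimes> b'"] c c' by simp
  have "(a \<otimes> b) \<otimes> (b' \<otimes> a') \<otimes> (a \<otimes> b) = a \<otimes> ((b \<otimes> b') \<otimes> (a' \<otimes> a)) \<otimes> b"
    using c c' by (simp add: m_assoc)
  also have "\<dots> = (a \<otimes> a' \<otimes> a) \<otimes> (b \<otimes> b' \<otimes> b)"
    unfolding comm[symmetric] using c c' by (simp add: m_assoc)
  also have "\<dots> = a \<otimes> b"
    using a b by (simp add: inverse_normalizing_def)
  finally have 1: "(a \<otimes> b) \<otimes> (b' \<otimes> a') \<otimes> (a \<otimes> b) = a \<otimes> b" .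
  have "(b' \<otimes> a') \<otimes> (a \<otimes> b) \<otimes> (b' \<otimes> a') = b' \<otimes> ((a' \<otimes> a) \<otimes> (b \<otimes> b')) \<otimes> a'"
    using c c' by (simp add: m_assoc)
  also have "\<dots> = (b' \<otimes> b \<otimes> b') \<otimes> (a' \<otimes> a \<otimes> a')"
    unfolding comm using c c' by (simp add: m_assoc)
  also have "\<dots> = b' \<otimes> a'"
    using a b by (simp add: inverse_normalizing_def)
  finally have 2: "(b' \<otimes> a') \<otimes> (a \<otimes> b) \<otimes> (b' \<otimes> a') = b' \<otimes> a'" .
  have "(a \<otimes> b) \<otimes> p \<otimes> (b' \<otimes> a') \<in> E \<and> (b' \<otimes> a') \<otimes> p \<otimes> (a \<otimes> b) \<in> E" if p: "p \<in> E" for p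
  proof -
    have "(a \<otimes> b) \<otimes> p \<otimes> (b' \<otimes> a') = a \<otimes> (b \<otimes> p \<otimes> b') \<otimes> a'"
      "(b' \<otimes> a') \<otimes> p \<otimes> (a \<otimes> b) = b' \<otimes> (a' \<otimes> p \<otimes> a) \<otimes> b"
      using c c' E_closed[OF p] by (simp_all add: m_assoc)
    then show ?thesis
      using a b p by (simp add: inverse_normalizing_def)
  qed
  with 1 2 c' show ?thesis
    by (simp add: inverse_normalizing_def)
qed

text \<open>A unit is paired with its group inverse and \<open>z\<close> with itself, since
  \<open>z z z = z\<close>; products are handled by \<open>inverse_normalizing_mult\<close>.\<close>

lemma ex_inverse_normalizing:
  assumes "x \<in> carrier S"
  shows "\<exists>y. inverse_normalizing x y"
  using assms unfolding gen
proof induction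
  case one
  have "inverse_normalizing \<one> \<one>"
    by (simp add: inverse_normalizing_def E_closed)
  then show ?case ..
next
  case (incl g)
  then consider "g \<in> Units S" | "g = z"
    by blast
  then show ?case
  proof cases
    case 1
    then have "inverse_normalizing g (inv g)"
      by (simp add: inverse_normalizing_def conj_in_E conj_inv_in_E Units_closed)
    then show ?thesis ..
  next
    case 2
    then have "inverse_normalizing g z"
      by (simp add: inverse_normalizing_def sandwich_in_E zz ez)
    then show ?thesis ..
  qed
next
  case (mult a b)
  then show ?case
    using inverse_normalizing_mult unfolding gen by blast
qed

lemma idempotents_eq: "idempotents S = E"
proof (intro equalityI subsetI)
  fix x assume "x \<in> idempotents S"
  then have c: "x \<in> carrier S" and xx: "x \<otimes> x = x"
    by (auto simp: idempotents_def)
  obtain y where y: "inverse_normalizing x y"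
    using ex_inverse_normalizing[OF c] by blast
  then have cy: "y \<in> carrier S" and xyx: "x \<otimes> y \<otimes> x = x" and yxy: "y \<otimes> x \<otimes> y = y"
    and "x \<otimes> \<one> \<otimes> y \<in> E" "y \<otimes> \<one> \<otimes> x \<in> E"
    using gen_submonoid.one[of S conjugates] by (auto simp: inverse_normalizing_def)
  then have xy: "x \<otimes> y \<in> E" and yx: "y \<otimes> x \<in> E"
    using c by simp_all
  \<comment> \<open>Doubling the middle factor splits \<open>y\<close> into two members of
    \<open>E\<close>. Once \<open>y\<close> is known to be idempotent, the same device with the
    roles exchanged puts \<open>x\<close> in \<open>E\<close>.\<close>
  have "y = y \<otimes> (x \<otimes> x) \<otimes> y"
    by (simp add: xx yxy)
  also have "\<dots> = (y \<otimes> x) \<otimes> (x \<otimes> y)"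
    using c cy by (simp add: m_assoc)
  finally have "y \<in> E"
    using gen_submonoid.mult[OF yx xy] by simp
  then have yy: "y \<otimes> y = y"
    by (rule E_idem)
  have "x = x \<otimes> (y \<otimes> y) \<otimes> x"
    by (simp add: yy xyx)
  also have "\<dots> = (x \<otimes> y) \<otimes> (y \<otimes> x)"
    using c cy by (simp add: m_assoc)
  finally show "x \<in> E"
    using gen_submonoid.mult[OF xy yx] by simp
qed (auto simp: idempotents_def E_closed E_idem)

lemma inverse_monoid: "inverse_monoid S"
proof (rule inverse_monoidI)
  fix a assume "a \<in> carrier S"
  then show "\<exists>b\<in>carrier S. a \<otimes> b \<otimes> a = a \<and> b \<otimes> a \<otimes> b = b"
    using ex_inverse_normalizing by (auto simp: inverse_normalizing_def)
qed (use idempotents_eq E_commute in blast)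

lemma factorizable_part_eq_gen: "factorizable_part S = gen_submonoid S (Units S \<union> {e})"
  unfolding factorizable_part_def idempotents_eq gen_submonoid_Units_eq ..

end

section \<open>The two implications, with \<open>e\<close> for \<open>z^2\<close>\<close>

theorem proposition2:
  fixes S :: "('a, 'b) monoid_scheme" (structure) and z :: 'a
  assumes "monoid S"
    and "z \<in> carrier S"
    and "carrier S = gen_submonoid S (Units S \<union> {z})"
    and "z [^] (3::nat) = z"
  shows "(inverse_monoid S
      \<and> idempotents S = gen_submonoid S {inv g \<otimes> z [^] (2::nat) \<otimes> g | g. g \<in> Units S}
      \<and> factorizable_part S = gen_submonoid S (Units S \<union> {z [^] (2::nat)}))
    \<longleftrightarrow> (\<forall>g \<in> Units S.
      inv g \<otimes> z [^] (2::nat) \<otimes> g \<otimes> z [^] (2::nat) = z [^] (2::nat) \<otimes> inv g \<otimes> z [^] (2::nat) \<otimes> g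
      \<and> z \<otimes> inv g \<otimes> z [^] (2::nat) \<otimes> g \<otimes> z \<in> gen_submonoid S (Units S \<union> {z [^] (2::nat)}))"
proof -
  interpret monoid S by fact
  define e where "e = z [^] (2::nat)"
  have z: "z \<in> carrier S" by fact
  have zz: "z \<otimes> z = e"
    using z by (simp add: e_def numeral_2_eq_2)
  have e: "e \<in> carrier S"
    using z by (simp add: e_def)
  have ez: "e \<otimes> z = z"
    using assms(4) z by (simp add: e_def numeral_2_eq_2 numeral_3_eq_3)
  then have ee: "e \<otimes> e = e"
    using z e by (metis zz m_assoc)
  have ze: "z \<otimes> e = z"
    using ez z zz m_assoc[of z z z] by simp
  show ?thesis
    unfolding e_def[symmetric]
  proof
    assume L: "inverse_monoid S
      \<and> idempotents S = gen_submonoid S {inv g \<otimes> e \<otimes> g | g. g \<in> Units S}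
      \<and> factorizable_part S = gen_submonoid S (Units S \<union> {e})"
    then interpret inverse_monoid S by blast
    show "\<forall>g \<in> Units S. inv g \<otimes> e \<otimes> g \<otimes> e = e \<otimes> inv g \<otimes> e \<otimes> g
      \<and> z \<otimes> inv g \<otimes> e \<otimes> g \<otimes> z \<in> gen_submonoid S (Units S \<union> {e})"
    proof
      fix g assume g: "g \<in> Units S"
      define p where "p = inv g \<otimes> e \<otimes> g"
      have e_idem: "e \<in> idempotents S"
        using e ee by (simp add: idempotents_def)
      then have p_idem: "p \<in> idempotents S"
        unfolding p_def using g by (rule idempotents_conj)
      then have p: "p \<in> carrier S" "p \<otimes> p = p"
        by (auto simp: idempotents_def)
      have pe: "p \<otimes> e = e \<otimes> p"
        using p_idem e_idem by (rule idempotents_commute)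
      \<comment> \<open>For (C2) it is enough that \<open>z p z\<close> is idempotent: the inner
        \<open>z z = e\<close> commutes with \<open>p\<close> and disappears into the left
        \<open>z\<close>.\<close>
      have "(z \<otimes> p \<otimes> z) \<otimes> (z \<otimes> p \<otimes> z) = z \<otimes> (p \<otimes> (z \<otimes> z)) \<otimes> p \<otimes> z"
        using p(1) z by (simp add: m_assoc)
      also have "\<dots> = (z \<otimes> e) \<otimes> (p \<otimes> p) \<otimes> z"
        unfolding zz pe using p(1) z e by (simp add: m_assoc)
      finally have "z \<otimes> p \<otimes> z \<in> idempotents S"
        using p z by (simp add: idempotents_def ze)
      \<comment> \<open>An idempotent times the unit \<open>\<one>\<close> lies in the factorizable
        part, which by assumption is generated by the units and \<open>e\<close>.\<close>
      then have "(z \<otimes> p \<otimes> z) \<otimes> \<one> \<in> factorizable_part S"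
        unfolding factorizable_part_def set_mult_def using Units_one_closed by blast
      then have "z \<otimes> p \<otimes> z \<in> gen_submonoid S (Units S \<union> {e})"
        using L p(1) z by simp
      then show "inv g \<otimes> e \<otimes> g \<otimes> e = e \<otimes> inv g \<otimes> e \<otimes> g
        \<and> z \<otimes> inv g \<otimes> e \<otimes> g \<otimes> z \<in> gen_submonoid S (Units S \<union> {e})"
        using pe g z e by (simp add: p_def m_assoc Units_closed)
    qed
  next
    assume R: "\<forall>g \<in> Units S. inv g \<otimes> e \<otimes> g \<otimes> e = e \<otimes> inv g \<otimes> e \<otimes> g
      \<and> z \<otimes> inv g \<otimes> e \<otimes> g \<otimes> z \<in> gen_submonoid S (Units S \<union> {e})"
    \<comment> \<open>(C1) and (C2) differ from the locale assumptions only in bracketing.\<close>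
    interpret sandwich_condition S e z
    proof
      fix g assume g: "g \<in> Units S"
      show "(inv g \<otimes> e \<otimes> g) \<otimes> e = e \<otimes> (inv g \<otimes> e \<otimes> g)"
        "z \<otimes> (inv g \<otimes> e \<otimes> g) \<otimes> z \<in> gen_submonoid S (Units S \<union> {e})"
        using bspec[OF R g] g z e by (simp_all add: m_assoc Units_closed)
    qed (fact e ee z zz ez assms(3))+
    show "inverse_monoid S
      \<and> idempotents S = gen_submonoid S {inv g \<otimes> e \<otimes> g | g. g \<in> Units S}
      \<and> factorizable_part S = gen_submonoid S (Units S \<union> {e})"
      by (simp only: inverse_monoid idempotents_eq factorizable_part_eq_gen simp_thms)
  qed
qed

end
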